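(* If a string of numbers $(a_1,\dots,a_n)$ belongs to $\mathrm{Spec}(J_1,\dots,J_n)$, then it belongs to $\mathrm{Cont}_m(n)$.
   Context: Parameters. Let $m,n\ge 1$. Either $K=\mathbb{C}(q,v_1,\dots,v_m)$ with $q,v_1,\dots,v_m$ indeterminates, or $K=\mathbb{C}$ and $q,v_1,\dots,v_m\in\mathbb{C}$, $q\neq0$, satisfy: $1+q^2+\dots+q^{2N}\neq0$ for all non-negative integers $N<n$; $q^{2i}v_j-v_k\neq0$ for all $i,j,k$ with $j\neq k$ and $-n<i<n$; $v_j\neq0$ for all $j=1,\dots,m$. Cyclotomic Hecke algebra. $H(m,1,n)$ is the associative unital $K$-algebra generated by $\tau,\sigma_1,\dots,\sigma_{n-1}$ with defining relations $\sigma_i\sigma_{i+1}\sigma_i=\sigma_{i+1}\sigma_i\sigma_{i+1}$; $\sigma_i\sigma_j=\sigma_j\sigma_i$ if $|i-j|>1$; $\tau\sigma_1\tau\sigma_1=\sigma_1\tau\sigma_1\tau$; $\tau\sigma_i=\sigma_i\tau$ for $i>1$; $\sigma_i^2=(q-q^{-1})\sigma_i+1$; $(\tau-v_1)\cdots(\tau-v_m)=0$. The Jucys--Murphy elements are $J_1=\tau$, $J_{i+1}=\sigma_iJ_i\sigma_i$; they commute with each other. $C$-representations. A representation of $H(m,1,n)$ over $K$ is a $C$-representation if $J_1,\dots,J_n$ act by diagonalizable operators and, for every $i=1,\dots,n-1$, the action of the subalgebra generated by $J_i,J_{i+1},\sigma_i$ is completely reducible. $\mathrm{Spec}(J_1,\dots,J_n)$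 is the set of strings $(a_1,\dots,a_n)$ for which there is a nonzero vector $e$ in the space of some $C$-representation with $J_i(e)=a_ie$ for all $i=1,\dots,n$. Content strings. A content string $(a_1,\dots,a_n)$ is a string of numbers (elements of $K$) satisfying the following conditions: (c1) $a_1\in\{v_1,\dots,v_m\}$; (c2) for all $j>1$: if $a_j=v_kq^{2z}$ for some $k$ and some integer $z\neq0$, then $\{v_kq^{2(z-1)},v_kq^{2(z+1)}\}\cap\{a_1,\dots,a_{j-1}\}\neq\varnothing$; (c3) if $a_i=a_j=v_kq^{2z}$ with $i<j$ for some $k$ and some integer $z$, then $\{v_kq^{2(z-1)},v_kq^{2(z+1)}\}\subset\{a_{i+1},\dots,a_{j-1}\}$. $\mathrm{Cont}_m(n)$ is the set of content strings of length $n$.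
   Formalization: For complex parameters with n≥2, q²≠1 is assumed (the claim fails if q²=1), and (c2) is imposed only on a_j outside {v_1,…,v_m} (literal (c2) fails, e.g. m=n=2, q=2, v_2=16v_1, string (v_1,v_2)); for indeterminates nothing changes. *)

theory Defs
  imports
    Complex_Main
    "HOL-Library.Poly_Mapping"
    "HOL-Library.Option_ord"
    "HOL-Computational_Algebra.Fraction_Field"
    "HOL-Algebra.Generated_Rings"
    "HOL-Algebra.QuotRing"
begin

section \<open>Parameters\<close>

text \<open>
  The number m of parameters \<open>v\<^sub>1, \<dots>, v\<^sub>m\<close> is the cardinality of a finite index type \<open>'m\<close>
  (hence at least 1), whose linear order is the enumeration \<open>1, \<dots>, m\<close>.

  In the generic case the field is the fraction field of the polynomial ring over the complex
  numbers in m + 1 variables. The variables are indexed by \<open>'m option\<close>: \<open>None\<close> stands for q and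
  \<open>Some j\<close> for \<open>v\<^sub>j\<close>. A polynomial is a finitely supported function from monomials to coefficients.
\<close>

type_synonym 'm ratfun = "(('m option \<Rightarrow>\<^sub>0 nat) \<Rightarrow>\<^sub>0 complex) fract"

definition indet :: "'m option \<Rightarrow> 'm::{finite,linorder} ratfun" where
  "indet x = Fraction_Field.Fract (Poly_Mapping.single (Poly_Mapping.single x 1) 1) 1"

definition generic_q :: "'m::{finite,linorder} ratfun" where
  "generic_q = indet None"

definition generic_v :: "'m::{finite,linorder} \<Rightarrow> 'm ratfun" where
  "generic_v j = indet (Some j)"

definition admissible :: "complex \<Rightarrow> ('m \<Rightarrow> complex) \<Rightarrow> nat \<Rightarrow> bool" where
  "admissible q v n \<longleftrightarrow>
     q \<noteq> 0 \<and>
     (\<forall>N<n. (\<Sum>i\<le>N. q ^ (2 * i)) \<noteq> 0) \<and>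
     (\<forall>j k. \<forall>i::int. j \<noteq> k \<and> - int n < i \<and> i < int n \<longrightarrow> q powi (2 * i) * v j \<noteq> v k) \<and>
     (\<forall>j. v j \<noteq> 0)"


section \<open>The cyclotomic Hecke algebra\<close>

subsection \<open>Free associative algebras\<close>

text \<open>
  The free monoid is written additively, so that finitely supported functions on it form the
  (non-commutative) monoid algebra via the convolution product of \<^theory>\<open>HOL-Library.Poly_Mapping\<close>.
\<close>

datatype 'g free_mon = Wrd (letters: "'g list")

instantiation free_mon :: (type) monoid_add
begin

definition zero_free_mon :: "'a free_mon" where
  "zero_free_mon = Wrd []"

definition plus_free_mon :: "'a free_mon \<Rightarrow> 'a free_mon \<Rightarrow> 'a free_mon" where
  "plus_free_mon u w = Wrd (letters u @ letters w)"

instance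
  by standard (simp_all add: zero_free_mon_def plus_free_mon_def)

end

definition free_algebra :: "'g set \<Rightarrow> ('g free_mon \<Rightarrow>\<^sub>0 'k::field) ring" where
  "free_algebra X =
     \<lparr>carrier = {p. \<forall>w \<in> Poly_Mapping.keys p. set (letters w) \<subseteq> X},
      mult = (*), one = 1, zero = 0, add = (+)\<rparr>"

definition fvar :: "'g \<Rightarrow> 'g free_mon \<Rightarrow>\<^sub>0 'k::field" where
  "fvar g = Poly_Mapping.single (Wrd [g]) 1"

definition fconst :: "'k \<Rightarrow> 'g free_mon \<Rightarrow>\<^sub>0 'k::field" where
  "fconst c = Poly_Mapping.single 0 c"

lemma keys_uminus_free:
  "Poly_Mapping.keys (- p) = Poly_Mapping.keys (p :: 'g \<Rightarrow>\<^sub>0 'k::ab_group_add)"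
  by (auto simp: in_keys_iff)

lemma free_algebra_fields:
  "mult (free_algebra X) = (*)" "one (free_algebra X) = 1"
  "zero (free_algebra X) = 0" "add (free_algebra X) = (+)"
  by (simp_all add: free_algebra_def)

lemma free_algebra_carrier:
  "p \<in> carrier (free_algebra X) \<longleftrightarrow> (\<forall>w \<in> Poly_Mapping.keys p. set (letters w) \<subseteq> X)"
  by (simp add: free_algebra_def)

lemma ring_free_algebra: "ring (free_algebra X :: ('g free_mon \<Rightarrow>\<^sub>0 'k::field) ring)"
proof -
  let ?C = "carrier (free_algebra X :: ('g free_mon \<Rightarrow>\<^sub>0 'k) ring)"
  have add: "p + r \<in> ?C" if "p \<in> ?C" "r \<in> ?C" for p r
    using that Poly_Mapping.keys_add[of p r] unfolding free_algebra_carrier by blast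
  have mult: "p * r \<in> ?C" if "p \<in> ?C" "r \<in> ?C" for p r
    unfolding free_algebra_carrier
  proof
    fix w assume "w \<in> Poly_Mapping.keys (p * r)"
    then obtain x y where "w = x + y" "x \<in> Poly_Mapping.keys p" "y \<in> Poly_Mapping.keys r"
      using keys_mult[of p r] by blast
    then show "set (letters w) \<subseteq> X"
      using that by (simp add: free_algebra_carrier plus_free_mon_def)
  qed
  have neg: "- p \<in> ?C" if "p \<in> ?C" for p
    using that unfolding free_algebra_carrier keys_uminus_free .
  have zero: "0 \<in> ?C" and one: "1 \<in> ?C"
    by (simp_all add: free_algebra_carrier zero_free_mon_def)
  show ?thesis
  proof (rule ringI)
    show "abelian_group (free_algebra X :: ('g free_mon \<Rightarrow>\<^sub>0 'k::field) ring)"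
    proof (rule abelian_groupI, unfold free_algebra_fields)
      fix x assume "x \<in> ?C"
      then show "\<exists>y\<in>?C. y + x = 0"
        using neg[of x] by (intro bexI[of _ "- x"]) simp_all
    qed (rule add zero | simp add: add.assoc add.commute)+
    show "Group.monoid (free_algebra X :: ('g free_mon \<Rightarrow>\<^sub>0 'k::field) ring)"
      by (rule monoidI, unfold free_algebra_fields) (rule mult one | simp add: mult.assoc)+
  qed (simp_all only: free_algebra_fields distrib_left distrib_right)
qed

subsection \<open>Generators and relations\<close>

datatype hgen = Tau | Sig nat

definition hgens :: "nat \<Rightarrow> hgen set" where
  "hgens n = insert Tau (Sig ` {1..<n})"

definition hrels :: "'k::field \<Rightarrow> ('m::{finite,linorder} \<Rightarrow> 'k) \<Rightarrow> nat \<Rightarrow> (hgen free_mon \<Rightarrow>\<^sub>0 'k) set" where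
  "hrels q v n = (let t = fvar Tau; s = (\<lambda>i. fvar (Sig i)) in
     {s i * s (i + 1) * s i - s (i + 1) * s i * s (i + 1) | i. 1 \<le> i \<and> i + 1 < n} \<union>
     {s i * s j - s j * s i | i j. 1 \<le> i \<and> i < n \<and> 1 \<le> j \<and> j < n \<and> \<bar>int i - int j\<bar> > 1} \<union>
     (if 1 < n then {t * s 1 * t * s 1 - s 1 * t * s 1 * t} else {}) \<union>
     {t * s i - s i * t | i. 1 < i \<and> i < n} \<union>
     {s i * s i - (fconst (q - inverse q) * s i + 1) | i. 1 \<le> i \<and> i < n} \<union>
     {prod_list (map (\<lambda>k. t - fconst (v k)) (sorted_list_of_set UNIV))})"

definition Hecke :: "'k::field \<Rightarrow> ('m::{finite,linorder} \<Rightarrow> 'k) \<Rightarrow> nat \<Rightarrow> (hgen free_mon \<Rightarrow>\<^sub>0 'k) set ring" where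
  "Hecke q v n = free_algebra (hgens n) Quot (Idl\<^bsub>free_algebra (hgens n)\<^esub> (hrels q v n))"

text \<open>The canonical map from the free algebra onto its quotient.\<close>

definition Hcls :: "'k::field \<Rightarrow> ('m::{finite,linorder} \<Rightarrow> 'k) \<Rightarrow> nat \<Rightarrow> (hgen free_mon \<Rightarrow>\<^sub>0 'k) \<Rightarrow> (hgen free_mon \<Rightarrow>\<^sub>0 'k) set" where
  "Hcls q v n p = (Idl\<^bsub>free_algebra (hgens n)\<^esub> (hrels q v n)) +>\<^bsub>free_algebra (hgens n)\<^esub> p"

definition Hscalar :: "'k::field \<Rightarrow> ('m::{finite,linorder} \<Rightarrow> 'k) \<Rightarrow> nat \<Rightarrow> 'k \<Rightarrow> (hgen free_mon \<Rightarrow>\<^sub>0 'k) set" where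
  "Hscalar q v n c = Hcls q v n (fconst c)"

definition Htau :: "'k::field \<Rightarrow> ('m::{finite,linorder} \<Rightarrow> 'k) \<Rightarrow> nat \<Rightarrow> (hgen free_mon \<Rightarrow>\<^sub>0 'k) set" where
  "Htau q v n = Hcls q v n (fvar Tau)"

definition Hsigma :: "'k::field \<Rightarrow> ('m::{finite,linorder} \<Rightarrow> 'k) \<Rightarrow> nat \<Rightarrow> nat \<Rightarrow> (hgen free_mon \<Rightarrow>\<^sub>0 'k) set" where
  "Hsigma q v n i = Hcls q v n (fvar (Sig i))"

lemma hrels_subset: "hrels q v n \<subseteq> carrier (free_algebra (hgens n))"
proof -
  interpret F: ring "free_algebra (hgens n) :: (hgen free_mon \<Rightarrow>\<^sub>0 'a) ring"
    by (rule ring_free_algebra)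
  let ?C = "carrier (free_algebra (hgens n) :: (hgen free_mon \<Rightarrow>\<^sub>0 'a) ring)"
  have add: "p + r \<in> ?C" and mult: "p * r \<in> ?C" if "p \<in> ?C" "r \<in> ?C" for p r
    using F.a_closed[OF that] F.m_closed[OF that] by (simp_all only: free_algebra_fields)
  have neg: "- p \<in> ?C" if "p \<in> ?C" for p
    using that unfolding free_algebra_carrier keys_uminus_free .
  have minus: "p - r \<in> ?C" if "p \<in> ?C" "r \<in> ?C" for p r
    using add[OF that(1) neg[OF that(2)]] by (simp only: add_uminus_conv_diff)
  have one: "1 \<in> ?C" and const: "fconst c \<in> ?C" for c
    by (auto simp: free_algebra_carrier fconst_def zero_free_mon_def)
  have var: "fvar g \<in> ?C" if "g \<in> hgens n" for g
    using that by (simp add: free_algebra_carrier fvar_def)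
  have t: "fvar Tau \<in> ?C"
    by (rule var) (simp add: hgens_def)
  have s: "fvar (Sig i) \<in> ?C" if "1 \<le> i" "i < n" for i
    by (rule var) (use that in \<open>simp add: hgens_def\<close>)
  have prod: "prod_list ps \<in> ?C" if "set ps \<subseteq> ?C" for ps
    using that by (induction ps) (auto intro: one mult)
  show ?thesis
    unfolding hrels_def Let_def
  proof (intro Un_least subsetI, goal_cases)
    case (1 x) then show ?case by (elim CollectE exE conjE) (simp only:, intro minus mult s; linarith)
  next
    case (2 x) then show ?case by (elim CollectE exE conjE) (simp only:, intro minus mult s; assumption)
  next
    case (3 x)
    then have n: "1 < n" and x: "x = fvar Tau * fvar (Sig 1) * fvar Tau * fvar (Sig 1)
        - fvar (Sig 1) * fvar Tau * fvar (Sig 1) * fvar Tau"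
      by (simp_all split: if_splits)
    show ?case unfolding x by (intro minus mult t s order_refl n)
  next
    case (4 x) then show ?case by (elim CollectE exE conjE) (simp only:, intro minus mult t s; linarith)
  next
    case (5 x) then show ?case
      by (elim CollectE exE conjE) (simp only:, intro minus mult add one const s; assumption)
  next
    case (6 x)
    have "prod_list (map (\<lambda>k. fvar Tau - fconst (v k)) (sorted_list_of_set UNIV)) \<in> ?C"
      by (rule prod) (auto intro!: minus t const)
    with 6 show ?case by blast
  qed
qed

lemma ring_Hecke: "ring (Hecke q v n)"
  unfolding Hecke_def
  by (intro ideal.quotient_is_ring ring.genideal_ideal ring_free_algebra hrels_subset)

subsection \<open>Jucys--Murphy elements\<close>

text \<open>Indices start at 1; the value at 0 is a dummy.\<close>

fun JM :: "'k::field \<Rightarrow> ('m::{finite,linorder} \<Rightarrow> 'k) \<Rightarrow> nat \<Rightarrow> nat \<Rightarrow> (hgen free_mon \<Rightarrow>\<^sub>0 'k) set" where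
  "JM q v n 0 = \<zero>\<^bsub>Hecke q v n\<^esub>"
| "JM q v n (Suc 0) = Htau q v n"
| "JM q v n (Suc (Suc i)) =
     Hsigma q v n (Suc i) \<otimes>\<^bsub>Hecke q v n\<^esub> JM q v n (Suc i) \<otimes>\<^bsub>Hecke q v n\<^esub> Hsigma q v n (Suc i)"

definition subalgebra_gen :: "'k::field \<Rightarrow> ('m::{finite,linorder} \<Rightarrow> 'k) \<Rightarrow> nat
    \<Rightarrow> (hgen free_mon \<Rightarrow>\<^sub>0 'k) set set \<Rightarrow> (hgen free_mon \<Rightarrow>\<^sub>0 'k) set set" where
  "subalgebra_gen q v n X = generate_ring (Hecke q v n) (range (Hscalar q v n) \<union> X)"


section \<open>Representations\<close>

definition diagonalizable :: "('k::field \<Rightarrow> 'v::ab_group_add \<Rightarrow> 'v) \<Rightarrow> ('v \<Rightarrow> 'v) \<Rightarrow> bool" where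
  "diagonalizable scale f \<longleftrightarrow>
     (\<exists>B. \<not> module.dependent scale B \<and> module.span scale B = UNIV \<and>
          (\<forall>b\<in>B. \<exists>c. f b = scale c b))"

definition invariant_subspace :: "('k::field \<Rightarrow> 'v::ab_group_add \<Rightarrow> 'v) \<Rightarrow> ('v \<Rightarrow> 'v) set \<Rightarrow> 'v set \<Rightarrow> bool" where
  "invariant_subspace scale A U \<longleftrightarrow> module.subspace scale U \<and> (\<forall>f\<in>A. \<forall>u\<in>U. f u \<in> U)"

definition irreducible_subspace :: "('k::field \<Rightarrow> 'v::ab_group_add \<Rightarrow> 'v) \<Rightarrow> ('v \<Rightarrow> 'v) set \<Rightarrow> 'v set \<Rightarrow> bool" where
  "irreducible_subspace scale A U \<longleftrightarrow>
     invariant_subspace scale A U \<and> U \<noteq> {0} \<and>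
     (\<forall>W. invariant_subspace scale A W \<and> W \<subseteq> U \<longrightarrow> W = {0} \<or> W = U)"

text \<open>The whole space is the internal direct sum of a family of irreducible subspaces.\<close>

definition completely_reducible :: "('k::field \<Rightarrow> 'v::ab_group_add \<Rightarrow> 'v) \<Rightarrow> ('v \<Rightarrow> 'v) set \<Rightarrow> bool" where
  "completely_reducible scale A \<longleftrightarrow>
     (\<exists>\<S>. (\<forall>S\<in>\<S>. irreducible_subspace scale A S) \<and>
          module.span scale (\<Union>\<S>) = UNIV \<and>
          (\<forall>S\<in>\<S>. S \<inter> module.span scale (\<Union>(\<S> - {S})) = {0}))"

definition End_ring :: "('k::field \<Rightarrow> 'v::ab_group_add \<Rightarrow> 'v) \<Rightarrow> ('v \<Rightarrow> 'v) ring" where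
  "End_ring scale =
     \<lparr>carrier = {f. Vector_Spaces.linear scale scale f},
      mult = (\<circ>), one = id, zero = (\<lambda>x. 0), add = (\<lambda>f g x. f x + g x)\<rparr>"

definition representation :: "'k::field \<Rightarrow> ('m::{finite,linorder} \<Rightarrow> 'k) \<Rightarrow> nat
    \<Rightarrow> ('k \<Rightarrow> 'v::ab_group_add \<Rightarrow> 'v) \<Rightarrow> ((hgen free_mon \<Rightarrow>\<^sub>0 'k) set \<Rightarrow> 'v \<Rightarrow> 'v) \<Rightarrow> bool" where
  "representation q v n scale \<rho> \<longleftrightarrow>
     vector_space scale \<and>
     \<rho> \<in> ring_hom (Hecke q v n) (End_ring scale) \<and>
     (\<forall>c. \<rho> (Hscalar q v n c) = scale c)"

definition C_representation :: "'k::field \<Rightarrow> ('m::{finite,linorder} \<Rightarrow> 'k) \<Rightarrow> nat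
    \<Rightarrow> ('k \<Rightarrow> 'v::ab_group_add \<Rightarrow> 'v) \<Rightarrow> ((hgen free_mon \<Rightarrow>\<^sub>0 'k) set \<Rightarrow> 'v \<Rightarrow> 'v) \<Rightarrow> bool" where
  "C_representation q v n scale \<rho> \<longleftrightarrow>
     representation q v n scale \<rho> \<and>
     (\<forall>i\<in>{1..n}. diagonalizable scale (\<rho> (JM q v n i))) \<and>
     (\<forall>i\<in>{1..<n}. completely_reducible scale
        (\<rho> ` subalgebra_gen q v n {JM q v n i, JM q v n (i + 1), Hsigma q v n i}))"

text \<open>
  A string \<open>(a\<^sub>1, \<dots>, a\<^sub>n)\<close> is a list, so \<open>a\<^sub>i\<close> is \<open>a ! (i - 1)\<close>. Since one cannot quantify over types
  inside a definition, the representation space is any vector space on the type \<open>'v\<close>, and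
  membership in the spectrum is to be read with \<open>'v\<close> arbitrary.
\<close>

definition Spec :: "'k::field \<Rightarrow> ('m::{finite,linorder} \<Rightarrow> 'k) \<Rightarrow> nat \<Rightarrow> 'v::ab_group_add itself \<Rightarrow> 'k list set" where
  "Spec q v n T =
     {a. length a = n \<and>
         (\<exists>(scale :: 'k \<Rightarrow> 'v \<Rightarrow> 'v) \<rho>. C_representation q v n scale \<rho> \<and>
            (\<exists>e. e \<noteq> 0 \<and> (\<forall>i\<in>{1..n}. \<rho> (JM q v n i) e = scale (a ! (i - 1)) e)))}"


section \<open>Content strings\<close>

text \<open>
  In the second condition the exponent z of \<open>a\<^sub>j = v\<^sub>k q\<^sup>2\<^sup>z\<close> is meant to be well defined up to the question whether it
  is zero. For complex parameters it need not be: with \<open>v\<^sub>2 = v\<^sub>1 q\<^sup>2\<^sup>n\<close>, or q a root of unity of large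
  order, the number \<open>v\<^sub>2\<close> is also some \<open>v\<^sub>k q\<^sup>2\<^sup>z\<close> with z different from 0, although it is a legitimate
  eigenvalue with exponent 0. Hence the condition is read as speaking about numbers \<open>v\<^sub>k q\<^sup>2\<^sup>z\<close> with z different
  from 0 that are not themselves one of the \<open>v\<^sub>l\<close>. The extra clause is vacuous
  whenever no such coincidence occurs, see \<open>Cont_iff_literal\<close>; this includes the generic case, see
  \<open>generic_no_coincidence\<close>.
\<close>

definition Cont :: "'k::field \<Rightarrow> ('m::{finite,linorder} \<Rightarrow> 'k) \<Rightarrow> nat \<Rightarrow> 'k list set" where
  "Cont q v n =
     {a. length a = n \<and>
       a ! 0 \<in> range v \<and>
       (\<forall>j k. \<forall>z::int. 0 < j \<and> j < n \<and> z \<noteq> 0 \<and> a ! j = v k * q powi (2 * z) \<and> a ! j \<notin> range v \<longrightarrow>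
          {v k * q powi (2 * (z - 1)), v k * q powi (2 * (z + 1))} \<inter> (!) a ` {0..<j} \<noteq> {}) \<and>
       (\<forall>i j k. \<forall>z::int. i < j \<and> j < n \<and> a ! i = a ! j \<and> a ! j = v k * q powi (2 * z) \<longrightarrow>
          {v k * q powi (2 * (z - 1)), v k * q powi (2 * (z + 1))} \<subseteq> (!) a ` {i<..<j})}"

lemma Cont_iff_literal:
  assumes "\<And>j k (z::int). z \<noteq> 0 \<Longrightarrow> v k * q powi (2 * z) \<noteq> v j"
  shows "a \<in> Cont q v n \<longleftrightarrow>
     length a = n \<and>
     a ! 0 \<in> range v \<and>
     (\<forall>j k. \<forall>z::int. 0 < j \<and> j < n \<and> z \<noteq> 0 \<and> a ! j = v k * q powi (2 * z) \<longrightarrow>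
        {v k * q powi (2 * (z - 1)), v k * q powi (2 * (z + 1))} \<inter> (!) a ` {0..<j} \<noteq> {}) \<and>
     (\<forall>i j k. \<forall>z::int. i < j \<and> j < n \<and> a ! i = a ! j \<and> a ! j = v k * q powi (2 * z) \<longrightarrow>
        {v k * q powi (2 * (z - 1)), v k * q powi (2 * (z + 1))} \<subseteq> (!) a ` {i<..<j})"
proof -
  have "v k * q powi (2 * z) \<notin> range v" if "z \<noteq> 0" for k and z :: int
    using assms[OF that] by blast
  then have "z \<noteq> 0 \<and> x = v k * q powi (2 * z) \<and> x \<notin> range v \<longleftrightarrow>
             z \<noteq> 0 \<and> x = v k * q powi (2 * z)" for x k and z :: int
    by metis
  then show ?thesis
    by (simp only: Cont_def mem_Collect_eq)
qed

lemma indet_power: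
  "indet x ^ N = Fraction_Field.Fract (Poly_Mapping.single (Poly_Mapping.single x N) 1) (1 :: (_ \<Rightarrow>\<^sub>0 nat) \<Rightarrow>\<^sub>0 complex)"
  by (induction N)
    (simp_all add: indet_def Fraction_Field.One_fract_def mult_single single_add[symmetric])

lemma generic_no_coincidence:
  fixes z :: int and j k :: "'m::{finite,linorder}"
  assumes "z \<noteq> 0"
  shows "generic_v k * generic_q powi (2 * z) \<noteq> generic_v j"
proof -
  have key: "indet (Some k) * indet None ^ N \<noteq> indet (Some j)"
    if "N > 0" for N and j k :: 'm
  proof
    assume "indet (Some k) * indet None ^ N = indet (Some j)"
    then have "Poly_Mapping.single (Poly_Mapping.single (Some k) 1 + Poly_Mapping.single None N) (1::complex)
        = Poly_Mapping.single (Poly_Mapping.single (Some j) 1) 1"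
      unfolding indet_power by (simp add: indet_def mult_single Fraction_Field.eq_fract)
    then have "Poly_Mapping.keys (Poly_Mapping.single (Poly_Mapping.single (Some k) 1 + Poly_Mapping.single None N) (1::complex))
        = Poly_Mapping.keys (Poly_Mapping.single (Poly_Mapping.single (Some j) 1) (1::complex))"
      by (rule arg_cong)
    then have "Poly_Mapping.single (Some k) (1::nat) + Poly_Mapping.single None N
        = Poly_Mapping.single (Some j) 1"
      by simp
    from arg_cong[OF this, of "\<lambda>p. Poly_Mapping.lookup p None"] show False
      using that by (simp add: lookup_add lookup_single)
  qed
  have nz: "indet None \<noteq> (0 :: 'm ratfun)"
    by (simp add: indet_def Fraction_Field.Zero_fract_def Fraction_Field.eq_fract)
      (metis lookup_single_eq lookup_zero zero_neq_one)
  show ?thesis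
  proof (cases "z > 0")
    case True
    then obtain N where "z = int N" "N > 0"
      by (metis zero_less_imp_eq_int)
    then show ?thesis
      using key[of "2 * N" k j] by (simp add: generic_v_def generic_q_def power_int_def nat_mult_distrib)
  next
    case False
    then obtain N where N: "z = - int N" "N > 0"
      using assms by (metis int_cases3 of_nat_0_less_iff linorder_neqE_linordered_idom)
    have pw: "generic_q powi (2 * z) = inverse (indet None ^ (2 * N) :: 'm ratfun)"
      using N by (simp add: power_int_def nat_mult_distrib power_inverse generic_q_def)
    show ?thesis
    proof
      assume "generic_v k * generic_q powi (2 * z) = generic_v j"
      then have "indet (Some j) = indet (Some k) * inverse (indet None ^ (2 * N))"
        unfolding pw generic_v_def by simp
      then have "indet (Some j) * indet None ^ (2 * N) = indet (Some k)"
        using nz by (simp only: mult.assoc) (simp del: power_mult)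
      then show False
        using key[of "2 * N" j k] N by simp
    qed
  qed
qed

end

theory Submission
  imports Defs
begin

text \<open>
  Let \<open>e\<close> be a joint eigenvector with eigenvalues \<open>a\<close> and \<open>b\<close> at positions \<open>i\<close> and \<open>i + 1\<close>.
  If \<open>a = b \<noteq> 0\<close>, then \<open>\<sigma>\<^sub>i e\<close> is a generalized but not a genuine eigenvector of \<open>J\<^sub>i\<^sub>+\<^sub>1\<close>, so
  adjacent entries differ. If \<open>b \<noteq> q\<^sup>2 a\<close> and \<open>a \<noteq> q\<^sup>2 b\<close>, an intertwiner produces a joint eigenvector for the
  string with \<open>a\<close> and \<open>b\<close> exchanged. Otherwise complete reducibility forces \<open>\<sigma>\<^sub>i e\<close> to be \<open>q e\<close> or
  \<open>- q\<inverse> e\<close>, and the braid relation then excludes three consecutive entries \<open>a\<close>, \<open>q\<^sup>\<plusminus>\<^sup>2 a\<close>, \<open>a\<close>.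
  The conditions on content strings follow by moving entries past unlinked neighbours until
  one of these forbidden configurations, or a first entry outside \<open>{v\<^sub>1, \<dots>, v\<^sub>m}\<close>, appears.
\<close>

section \<open>Linear algebra\<close>

text \<open>Expand \<open>x\<close> in an eigenbasis with eigenvalues \<open>d b\<close>. The
  coordinates of \<open>y\<close> are \<open>r b * (d b - c)\<close>, and applying
  \<open>f - c\<close> once more shows that \<open>r b * (d b - c)^2\<close> is zero, so the
  coordinates vanish already.\<close>

lemma (in vector_space) diagonalizable_no_generalized_eigenvector:
  assumes diag: "diagonalizable scale f" and lin: "Vector_Spaces.linear scale scale f"
    and fx: "f x = scale c x + y" and fy: "f y = scale c y"
  shows "y = 0"
proof -
  interpret f: Vector_Spaces.linear scale scale f by (rule lin)
  obtain B where B: "independent B" "span B = UNIV" "\<And>b. b \<in> B \<Longrightarrow> \<exists>d. f b = scale d b"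
    using diag unfolding diagonalizable_def by blast
  obtain d where d: "\<And>b. b \<in> B \<Longrightarrow> f b = scale (d b) b"
    using B(3) by metis
  have "x \<in> span B" using B(2) by simp
  then obtain t r where t: "finite t" "t \<subseteq> B" and x: "x = (\<Sum>b\<in>t. scale (r b) b)"
    unfolding span_explicit by blast
  have fcomb: "f (\<Sum>b\<in>t. scale (s b) b) = (\<Sum>b\<in>t. scale (s b * d b) b)" for s
    unfolding f.sum by (intro sum.cong refl) (use t d in \<open>auto simp: f.scale\<close>)
  have y: "y = (\<Sum>b\<in>t. scale (r b * (d b - c)) b)"
  proof -
    have "y = f x - scale c x" using fx by simp
    also have "\<dots> = (\<Sum>b\<in>t. scale (r b * d b) b - scale (c * r b) b)"
      unfolding x fcomb by (simp add: scale_sum_right sum_subtractf)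
    finally show ?thesis
      by (simp add: algebra_simps)
  qed
  have "0 = f y - scale c y" using fy by simp
  also have "\<dots> = (\<Sum>b\<in>t. scale (r b * (d b - c) * d b) b - scale (c * (r b * (d b - c))) b)"
    unfolding y fcomb by (simp add: scale_sum_right sum_subtractf)
  also have "\<dots> = (\<Sum>b\<in>t. scale (r b * (d b - c) * (d b - c)) b)"
    unfolding scale_left_diff_distrib[symmetric] by (simp add: right_diff_distrib ac_simps)
  finally have "r b * (d b - c) * (d b - c) = 0" if "b \<in> t" for b
    using independentD[OF B(1) t, of "\<lambda>b. r b * (d b - c) * (d b - c)" b] that by simp
  then show "y = 0" unfolding y by (intro sum.neutral) auto
qed

lemma (in vector_space) span_Union_finite_sum:
  assumes sub: "\<And>S. S \<in> \<S> \<Longrightarrow> subspace S" and e: "e \<in> span (\<Union>\<S>)"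
  obtains F x where "finite F" "F \<subseteq> \<S>" "\<And>S. S \<in> F \<Longrightarrow> x S \<in> S" "e = (\<Sum>S\<in>F. x S)"
proof -
  from e have "\<exists>F x. finite F \<and> F \<subseteq> \<S> \<and> (\<forall>S\<in>F. x S \<in> S) \<and> e = (\<Sum>S\<in>F. x S)"
  proof (induction rule: span_induct_alt)
    case base
    show ?case by (rule exI[of _ "{}"]) simp
  next
    case (step c u y)
    then obtain F x U where F: "finite F" "F \<subseteq> \<S>" "\<forall>S\<in>F. x S \<in> S" "y = (\<Sum>S\<in>F. x S)"
      and U: "U \<in> \<S>" "u \<in> U" by blast
    \<comment> \<open>\<open>U\<close> may already contribute to the decomposition of
      \<open>y\<close>; the new vector is then merged with its old component.\<close>
    define x' where "x' = x(U := scale c u + (if U \<in> F then x U else 0))"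
    have "x' S \<in> S" if "S \<in> insert U F" for S
      using that F(3) U sub[OF U(1)]
      by (auto simp: x'_def intro!: subspace_add subspace_scale subspace_0)
    moreover have "(\<Sum>S\<in>insert U F. x' S) = scale c u + y"
    proof -
      have "(\<Sum>S\<in>insert U F. x' S) = x' U + (\<Sum>S\<in>F - {U}. x' S)"
        using F(1) by (simp add: sum.insert_remove)
      also have "(\<Sum>S\<in>F - {U}. x' S) = (\<Sum>S\<in>F - {U}. x S)"
        by (rule sum.cong) (auto simp: x'_def)
      also have "x' U + \<dots> = scale c u + y"
        unfolding F(4) using F(1) by (auto simp: x'_def sum.remove[of F U] add.assoc)
      finally show ?thesis .
    qed
    ultimately show ?case
      using F U by (intro exI[of _ "insert U F"] exI[of _ x']) auto
  qed
  then show thesis using that by blast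
qed

text \<open>Each term is minus the sum of the others, so it lies in an intersection that directness
  makes zero. This allows eigenvector equations to be read component by component.\<close>

lemma (in vector_space) direct_sum_zero:
  assumes sub: "\<And>S. S \<in> \<S> \<Longrightarrow> subspace S"
    and direct: "\<And>S. S \<in> \<S> \<Longrightarrow> S \<inter> span (\<Union>(\<S> - {S})) = {0}"
    and F: "finite F" "F \<subseteq> \<S>" "\<And>S. S \<in> F \<Longrightarrow> x S \<in> S" "(\<Sum>S\<in>F. x S) = 0"
    and S: "S \<in> F"
  shows "x S = 0"
proof -
  have "x S = - (\<Sum>U\<in>F - {S}. x U)"
    using F(1,4) S by (simp add: sum.remove[of F S] eq_neg_iff_add_eq_0)
  moreover have "(\<Sum>U\<in>F - {S}. x U) \<in> span (\<Union>(\<S> - {S}))"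
    by (intro span_sum span_base) (use F in auto)
  ultimately have "x S \<in> S \<inter> span (\<Union>(\<S> - {S}))"
    using F(3)[OF S] by (simp add: span_neg)
  then show ?thesis using direct F(2) S by blast
qed

section \<open>Operators satisfying the Hecke relations\<close>

text \<open>The trace that generation of \<open>A\<close> by \<open>X\<close> leaves on single
  vectors. It lets the locale below speak of operators alone, without subalgebras of the Hecke
  algebra.\<close>

definition preserves_eigenlines ::
    "('k::field \<Rightarrow> 'v::ab_group_add \<Rightarrow> 'v) \<Rightarrow> ('v \<Rightarrow> 'v) set \<Rightarrow> ('v \<Rightarrow> 'v) set \<Rightarrow> bool" where
  "preserves_eigenlines scale X A \<longleftrightarrow>
     (\<forall>w. (\<forall>f\<in>X. \<exists>c. f w = scale c w) \<longrightarrow> (\<forall>g\<in>A. \<exists>c. g w = scale c w))"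

locale JM_operators = vector_space scale
  for scale :: "'k::field \<Rightarrow> 'v::ab_group_add \<Rightarrow> 'v" +
  fixes q :: 'k and n :: nat and J S :: "nat \<Rightarrow> 'v \<Rightarrow> 'v"
  assumes lin_J: "1 \<le> i \<Longrightarrow> i \<le> n \<Longrightarrow> Vector_Spaces.linear scale scale (J i)"
    and lin_S: "1 \<le> i \<Longrightarrow> i < n \<Longrightarrow> Vector_Spaces.linear scale scale (S i)"
    and quad: "1 \<le> i \<Longrightarrow> i < n \<Longrightarrow> S i (S i x) = scale (q - inverse q) (S i x) + x"
    and braid: "1 \<le> i \<Longrightarrow> Suc i < n \<Longrightarrow> S i (S (Suc i) (S i x)) = S (Suc i) (S i (S (Suc i) x))"
    and S_far: "1 \<le> i \<Longrightarrow> Suc i < j \<Longrightarrow> j < n \<Longrightarrow> S i (S j x) = S j (S i x)"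
    and J_1_S: "1 < i \<Longrightarrow> i < n \<Longrightarrow> J 1 (S i x) = S i (J 1 x)"
    and J_Suc: "1 \<le> i \<Longrightarrow> i < n \<Longrightarrow> J (Suc i) x = S i (J i (S i x))"
    and diag: "1 \<le> i \<Longrightarrow> i \<le> n \<Longrightarrow> diagonalizable scale (J i)"
    and cred: "1 \<le> i \<Longrightarrow> i < n \<Longrightarrow> \<exists>A. completely_reducible scale A \<and> {J i, J (Suc i), S i} \<subseteq> A \<and>
       (\<forall>g\<in>A. Vector_Spaces.linear scale scale g) \<and>
       preserves_eigenlines scale {J i, J (Suc i), S i} A"
    and q_nonzero: "q \<noteq> 0"
begin

section \<open>Commutation of Jucys-Murphy operators with distant generators\<close>

lemma J_S_below:
  assumes "1 \<le> k" "k < i" "i < n"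
  shows "J k (S i x) = S i (J k x)"
  using assms
proof (induction k arbitrary: x rule: nat_induct_at_least)
  case base
  then show ?case using J_1_S by simp
next
  case (Suc k)
  then show ?case by (simp add: J_Suc S_far)
qed

lemma J_S_above:
  assumes "Suc (Suc i) \<le> k" "1 \<le> i" "k \<le> n"
  shows "J k (S i x) = S i (J k x)"
  using assms
proof (induction k arbitrary: x rule: nat_induct_at_least)
  case base
  \<comment> \<open>Unfolding twice puts \<open>J i\<close> in the middle. The braid relation turns
    the \<open>S i\<close> on the right into an \<open>S (Suc i)\<close>, which passes
    \<open>J i\<close> and becomes an \<open>S i\<close> on the left by the braid relation
    again.\<close>
  have "J (Suc (Suc i)) (S i x) = S (Suc i) (S i (J i (S i (S (Suc i) (S i x)))))"
    using base by (simp add: J_Suc)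
  also have "\<dots> = S (Suc i) (S i (S (Suc i) (J i (S i (S (Suc i) x)))))"
    using base by (simp add: braid J_S_below)
  also have "\<dots> = S i (J (Suc (Suc i)) x)"
    using base by (simp add: J_Suc braid)
  finally show ?case .
next
  case (Suc k)
  then have "S k (S i y) = S i (S k y)" for y using S_far[of i k] by simp
  with Suc show ?case by (simp add: J_Suc)
qed

lemma J_S_commute:
  assumes "1 \<le> k" "k \<le> n" "1 \<le> i" "i < n" "k \<noteq> i" "k \<noteq> Suc i"
  shows "J k (S i x) = S i (J k x)"
  using assms J_S_below[of k i x] J_S_above[of i k x] by linarith

section \<open>Two neighbouring operators on a joint eigenvector\<close>

lemma J_S_Suc:
  assumes i: "1 \<le> i" "i < n" and e: "J i e = scale a e" "J (Suc i) e = scale b e"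
  shows "J (Suc i) (S i e) = scale a (S i e) + scale ((q - inverse q) * b) e"
    and "J i (S i e) = scale b (S i e) - scale ((q - inverse q) * b) e"
proof -
  interpret Si: Vector_Spaces.linear scale scale "S i" by (rule lin_S[OF i])
  interpret Ji: Vector_Spaces.linear scale scale "J i" using i by (intro lin_J) auto
  \<comment> \<open>Both formulas come from \<open>J (Suc i) = S i J i S i\<close> by reducing the
    square of \<open>S i\<close>, once on the left and once on the right.\<close>
  have "S i (J (Suc i) e) = scale (q - inverse q) (J (Suc i) e) + J i (S i e)"
    unfolding J_Suc[OF i] quad[OF i] ..
  then show "J i (S i e) = scale b (S i e) - scale ((q - inverse q) * b) e"
    unfolding e Si.scale by (simp add: algebra_simps)
  have "J (Suc i) (S i e) = S i (scale (q - inverse q) (J i (S i e)) + J i e)"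
    unfolding J_Suc[OF i] quad[OF i] Ji.add Ji.scale ..
  also have "\<dots> = scale (q - inverse q) (J (Suc i) e) + S i (J i e)"
    unfolding Si.add Si.scale J_Suc[OF i] ..
  finally show "J (Suc i) (S i e) = scale a (S i e) + scale ((q - inverse q) * b) e"
    unfolding e Si.scale by (simp add: algebra_simps)
qed

lemma adjacent_distinct:
  assumes i: "1 \<le> i" "i < n" and q: "q\<^sup>2 \<noteq> 1"
    and e: "e \<noteq> 0" "J i e = scale a e" "J (Suc i) e = scale b e" and a: "a \<noteq> 0"
  shows "a \<noteq> b"
proof
  assume ab: "a = b"
  interpret J': Vector_Spaces.linear scale scale "J (Suc i)" using i by (intro lin_J) auto
  let ?y = "scale ((q - inverse q) * b) e"
  have "J (Suc i) (S i e) = scale a (S i e) + ?y"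
    by (rule J_S_Suc[OF i e(2,3)])
  moreover have "J (Suc i) ?y = scale a ?y"
    unfolding J'.scale e(3) ab by (simp add: ac_simps)
  ultimately have "?y = 0"
    using i by (intro diagonalizable_no_generalized_eigenvector[OF diag lin_J, of "Suc i"]) auto
  then show False
    using e(1) a ab q q_nonzero by (auto simp: field_simps power2_eq_square)
qed

text \<open>The usual intertwiner \<open>\<sigma>\<^sub>i - (q - q\<inverse>) b / (b - a)\<close> interchanges the two eigenvalues.\<close>

lemma intertwined_eigenvector:
  assumes i: "1 \<le> i" "i < n" and e: "J i e = scale a e" "J (Suc i) e = scale b e"
    and c: "c * (b - a) = (q - inverse q) * b"
  defines "f \<equiv> S i e - scale c e"
  shows "J i f = scale b f" "J (Suc i) f = scale a f"
proof -
  interpret Ji: Vector_Spaces.linear scale scale "J i" using i by (intro lin_J) auto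
  interpret J': Vector_Spaces.linear scale scale "J (Suc i)" using i by (intro lin_J) auto
  show "J i f = scale b f" "J (Suc i) f = scale a f"
    unfolding f_def Ji.diff Ji.scale J'.diff J'.scale J_S_Suc[OF i e] e c[symmetric]
    by (simp_all add: algebra_simps)
qed

text \<open>Condition \<open>c2\<close> says that \<open>c\<close> is q or -1/q. If
  \<open>S i - c\<close> did not kill the component of \<open>e\<close> in some irreducible summand,
  the intertwined vector would span an invariant line, hence the whole summand, although its
  \<open>J i\<close>-eigenvalue is \<open>b\<close> while that of the component is
  \<open>a\<close>.\<close>

lemma S_scalar:
  assumes i: "1 \<le> i" "i < n" and e: "J i e = scale a e" "J (Suc i) e = scale b e"
    and ab: "a \<noteq> b" and c: "c * (b - a) = (q - inverse q) * b" and c2: "c\<^sup>2 = (q - inverse q) * c + 1"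
  shows "S i e = scale c e"
proof -
  interpret Si: Vector_Spaces.linear scale scale "S i" by (rule lin_S[OF i])
  interpret Ji: Vector_Spaces.linear scale scale "J i" using i by (intro lin_J) auto
  interpret J': Vector_Spaces.linear scale scale "J (Suc i)" using i by (intro lin_J) auto
  obtain A where A: "completely_reducible scale A" "J i \<in> A" "J (Suc i) \<in> A" "S i \<in> A"
    and linA: "\<forall>g\<in>A. Vector_Spaces.linear scale scale g"
    and line: "preserves_eigenlines scale {J i, J (Suc i), S i} A"
    using cred[OF i] by auto
  obtain \<S> where "(\<forall>U\<in>\<S>. irreducible_subspace scale A U) \<and> span (\<Union>\<S>) = UNIV \<and>
      (\<forall>U\<in>\<S>. U \<inter> span (\<Union>(\<S> - {U})) = {0})"
    using A(1) unfolding completely_reducible_def ..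
  then have irr: "\<And>U. U \<in> \<S> \<Longrightarrow> irreducible_subspace scale A U"
    and sp: "span (\<Union>\<S>) = UNIV"
    and direct: "\<And>U. U \<in> \<S> \<Longrightarrow> U \<inter> span (\<Union>(\<S> - {U})) = {0}"
    by (auto simp only:)
  have sub: "subspace U" and inv: "\<And>g u. g \<in> A \<Longrightarrow> u \<in> U \<Longrightarrow> g u \<in> U" if "U \<in> \<S>" for U
    using irr[OF that] unfolding irreducible_subspace_def invariant_subspace_def by auto
  obtain F x where F: "finite F" "F \<subseteq> \<S>" "\<And>U. U \<in> F \<Longrightarrow> x U \<in> U" and ex: "e = (\<Sum>U\<in>F. x U)"
    using span_Union_finite_sum[OF sub, of \<S> e] sp by auto
  \<comment> \<open>Every operator in \<open>A\<close> preserves the summands, so an eigenvector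
    equation for \<open>e\<close> splits.\<close>
  have comp: "g (x U) = scale d (x U)" if g: "g \<in> A" "g e = scale d e" and U: "U \<in> F" for g d U
  proof -
    interpret g: Vector_Spaces.linear scale scale g using linA g(1) by blast
    have "(\<Sum>U\<in>F. g (x U) - scale d (x U)) = 0"
      using g(2) unfolding ex by (simp add: g.sum scale_sum_right sum_subtractf)
    moreover have "g (x U) - scale d (x U) \<in> U" if "U \<in> F" for U
      using that F(2,3) inv[OF _ g(1)] sub by (intro subspace_diff subspace_scale) auto
    ultimately have "g (x U) - scale d (x U) = 0"
      using direct_sum_zero[OF sub direct F(1,2), of "\<lambda>U. g (x U) - scale d (x U)" U] U by blast
    then show ?thesis by simp
  qed
  have "S i (x U) = scale c (x U)" if U: "U \<in> F" for U
  proof (rule ccontr)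
    have U': "U \<in> \<S>" using U F(2) by blast
    define f where "f = S i (x U) - scale c (x U)"
    assume "S i (x U) \<noteq> scale c (x U)"
    then have f0: "f \<noteq> 0" by (simp add: f_def)
    have fU: "f \<in> U"
      unfolding f_def using inv[OF U' A(4)] F(3)[OF U] sub[OF U']
      by (intro subspace_diff subspace_scale) auto
    have xe: "J i (x U) = scale a (x U)" "J (Suc i) (x U) = scale b (x U)"
      using comp[OF A(2) e(1) U] comp[OF A(3) e(2) U] by auto
    have Jf: "J i f = scale b f" "J (Suc i) f = scale a f"
      unfolding f_def by (rule intertwined_eigenvector[OF i xe c])+
    \<comment> \<open>The roots of the quadratic relation have sum \<open>q - inverse q\<close> and
      product -1, so \<open>S i - c\<close> maps into the eigenspace of the other root.\<close>
    have Sf: "S i f = scale (q - inverse q - c) f"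
    proof -
      have "(q - inverse q - c) * c = - 1" using c2 by (simp add: algebra_simps power2_eq_square)
      then have "scale (q - inverse q - c) f
          = scale (q - inverse q - c) (S i (x U)) - scale (- 1) (x U)"
        unfolding f_def scale_right_diff_distrib scale_scale by simp
      then show ?thesis
        unfolding f_def Si.diff Si.scale quad[OF i] by (simp add: algebra_simps)
    qed
    have line_f: "\<exists>d. g f = scale d f" if "g \<in> A" for g
      using line Jf Sf that unfolding preserves_eigenlines_def by blast
    have "invariant_subspace scale A (span {f})"
      unfolding invariant_subspace_def
    proof (intro conjI ballI)
      fix g u assume g: "g \<in> A" and "u \<in> span {f}"
      then obtain k where u: "u = scale k f" by (auto simp: span_singleton)
      interpret g: Vector_Spaces.linear scale scale g using linA g by blast
      obtain d where "g f = scale d f" using line_f[OF g] by blast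
      then have "g u = scale (k * d) f" unfolding u g.scale by simp
      then show "g u \<in> span {f}" unfolding span_singleton by blast
    qed simp
    moreover have "span {f} \<subseteq> U" by (rule span_minimal) (use fU sub[OF U'] in auto)
    moreover have "span {f} \<noteq> {0}" using f0 span_base[of f "{f}"] by auto
    ultimately have "span {f} = U"
      using irr[OF U'] unfolding irreducible_subspace_def by blast
    then obtain k where k: "x U = scale k f"
      using F(3)[OF U] by (auto simp: span_singleton)
    have "scale (k * b) f = scale (k * a) f"
      using xe(1) unfolding k Ji.scale Jf by (simp add: ac_simps)
    then have "x U = 0" using f0 ab k by auto
    then have "f = 0" by (simp add: f_def Si.zero)
    then show False using f0 by simp
  qed
  then show ?thesis unfolding ex Si.sum scale_sum_right by (intro sum.cong refl) auto
qed

text \<open>The space stays fixed, since exchanging entries yields another vector of the same space.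
  Lists count from 0 and operators from 1, hence the \<open>Suc\<close>.\<close>

definition weights :: "'k list set" where
  "weights = {a. length a = n \<and> (\<exists>e. e \<noteq> 0 \<and> (\<forall>i<n. J (Suc i) e = scale (a ! i) e))}"

lemma weights_distinct:
  assumes "a \<in> weights" "Suc i < n" "a ! i \<noteq> 0" "q\<^sup>2 \<noteq> 1"
  shows "a ! i \<noteq> a ! Suc i"
proof -
  obtain e where e: "e \<noteq> 0" "\<And>k. k < n \<Longrightarrow> J (Suc k) e = scale (a ! k) e"
    using assms(1) unfolding weights_def by blast
  show ?thesis
    by (rule adjacent_distinct[of "Suc i" e]) (use assms(2-4) e in auto)
qed

text \<open>The other operators commute with \<open>S (Suc i)\<close>, so the point is that the
  intertwined vector is nonzero. Otherwise \<open>e\<close> is an eigenvector of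
  \<open>S (Suc i)\<close> with eigenvalue q or -1/q, and the equation for \<open>c\<close> makes
  one entry q^2 times the other.\<close>

lemma weights_swap:
  assumes a: "a \<in> weights" and i: "Suc i < n" and neq: "a ! i \<noteq> a ! Suc i"
    "a ! Suc i \<noteq> q\<^sup>2 * a ! i" "a ! i \<noteq> q\<^sup>2 * a ! Suc i"
  shows "a[i := a ! Suc i, Suc i := a ! i] \<in> weights"
proof -
  obtain e where len: "length a = n" and e: "e \<noteq> 0" "\<And>k. k < n \<Longrightarrow> J (Suc k) e = scale (a ! k) e"
    using a unfolding weights_def by blast
  have i': "1 \<le> Suc i" "Suc i < n" using i by auto
  define c where "c = (q - inverse q) * a ! Suc i / (a ! Suc i - a ! i)"
  have c: "c * (a ! Suc i - a ! i) = (q - inverse q) * a ! Suc i"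
    using neq(1) by (simp add: c_def)
  define f where "f = S (Suc i) e - scale c e"
  interpret Si: Vector_Spaces.linear scale scale "S (Suc i)" by (rule lin_S[OF i'])
  have ei: "J (Suc i) e = scale (a ! i) e" "J (Suc (Suc i)) e = scale (a ! Suc i) e"
    using e(2) i by auto
  have f: "J (Suc i) f = scale (a ! Suc i) f" "J (Suc (Suc i)) f = scale (a ! i) f"
    unfolding f_def by (rule intertwined_eigenvector[OF i' ei c])+
  have "f \<noteq> 0"
  proof
    assume "f = 0"
    then have Se: "S (Suc i) e = scale c e" by (simp add: f_def)
    have "scale (c * c) e = scale ((q - inverse q) * c + 1) e"
      using quad[OF i', of e] unfolding Se Si.scale by (simp add: algebra_simps)
    then have "c * c = (q - inverse q) * c + 1" using e(1) by simp
    then have "(c - q) * (c + inverse q) = 0"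
      using q_nonzero by (simp add: algebra_simps)
    then consider "c = q" | "c = - inverse q" by (auto simp: eq_neg_iff_add_eq_0)
    then show False
    proof cases
      case 1
      then show False using c neq(2) q_nonzero by (auto simp: field_simps power2_eq_square)
    next
      case 2
      then have "a ! i = q\<^sup>2 * a ! Suc i"
        using c[unfolded 2] q_nonzero by (simp add: field_simps power2_eq_square)
      then show False using neq(3) by blast
    qed
  qed
  moreover have "J (Suc k) f = scale (a[i := a ! Suc i, Suc i := a ! i] ! k) f" if k: "k < n" for k
  proof (cases "k = i \<or> k = Suc i")
    case True
    then show ?thesis using f len i by auto
  next
    case False
    interpret Jk: Vector_Spaces.linear scale scale "J (Suc k)" using k by (intro lin_J) auto
    have "J (Suc k) (S (Suc i) e) = S (Suc i) (J (Suc k) e)"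
      using False k i by (intro J_S_commute) auto
    then have "J (Suc k) f = scale (a ! k) f"
      unfolding f_def Jk.diff Jk.scale e(2)[OF k] Si.scale by (simp add: algebra_simps)
    then show ?thesis using False by auto
  qed
  ultimately show ?thesis unfolding weights_def using len by auto
qed

text \<open>Two neighbouring generators would act on \<open>e\<close> by the two different roots q
  and -1/q, but the braid relation forces their scalars to agree.\<close>

lemma weights_no_sandwich:
  assumes a: "a \<in> weights" and i: "Suc (Suc i) < n" and eq: "a ! Suc (Suc i) = a ! i"
    and nz: "a ! i \<noteq> 0" and q: "q\<^sup>2 \<noteq> 1" "q\<^sup>2 \<noteq> - 1"
  shows "a ! Suc i \<noteq> q\<^sup>2 * a ! i" "a ! i \<noteq> q\<^sup>2 * a ! Suc i"
proof -
  obtain e where e: "e \<noteq> 0" "\<And>k. k < n \<Longrightarrow> J (Suc k) e = scale (a ! k) e"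
    using a unfolding weights_def by blast
  have ei: "J (Suc i) e = scale (a ! i) e" "J (Suc (Suc i)) e = scale (a ! Suc i) e"
      "J (Suc (Suc (Suc i))) e = scale (a ! i) e"
    using e(2)[of i] e(2)[of "Suc i"] e(2)[of "Suc (Suc i)"] i eq by auto
  interpret S1: Vector_Spaces.linear scale scale "S (Suc i)" using i by (intro lin_S) auto
  interpret S2: Vector_Spaces.linear scale scale "S (Suc (Suc i))" using i by (intro lin_S) auto
  have neq: "a ! i \<noteq> a ! Suc i" using weights_distinct[OF a _ nz q(1), of] i by simp
  \<comment> \<open>The two equations belong to the eigenvalue pairs at positions \<open>i\<close>,
    \<open>Suc i\<close> and at \<open>Suc i\<close>, \<open>Suc (Suc i)\<close>, which are
    reversals of each other.\<close>
  have bad: False if "c * (a ! Suc i - a ! i) = (q - inverse q) * a ! Suc i"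
      "d * (a ! i - a ! Suc i) = (q - inverse q) * a ! i"
      and cd: "c = q \<and> d = - inverse q \<or> c = - inverse q \<and> d = q" for c d
  proof -
    have "c\<^sup>2 = (q - inverse q) * c + 1" "d\<^sup>2 = (q - inverse q) * d + 1"
      using cd q_nonzero by (auto simp: algebra_simps power2_eq_square)
    then have "S (Suc i) e = scale c e" "S (Suc (Suc i)) e = scale d e"
      using S_scalar[OF _ _ ei(1,2) neq] S_scalar[OF _ _ ei(2,3) neq[symmetric]] that i by auto
    then have "scale (c * (d * c)) e = scale (d * (c * d)) e"
      using braid[of "Suc i" e] i by (simp add: S1.scale S2.scale ac_simps)
    then have "c * (d * c) = d * (c * d)" using e(1) by simp
    then show False using cd q q_nonzero by (auto simp: field_simps power2_eq_square)
  qed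
  show "a ! Suc i \<noteq> q\<^sup>2 * a ! i"
    using bad[of q "- inverse q"] q_nonzero by (auto simp: field_simps power2_eq_square)
  show "a ! i \<noteq> q\<^sup>2 * a ! Suc i"
    using bad[of "- inverse q" q] q_nonzero by (auto simp: field_simps power2_eq_square)
qed

end

section \<open>Combinatorics of strings\<close>

text \<open>What the combinatorics retains of the operators: \<open>t\<close> stands for q^2,
  \<open>R\<close> for the set of all \<open>v k\<close>, and \<open>P\<close> for
  \<open>weights\<close>.\<close>

locale swap_closed =
  fixes t :: "'k::field" and n :: nat and R :: "'k set" and P :: "'k list set"
  assumes t: "t \<noteq> 0"
    and len: "a \<in> P \<Longrightarrow> length a = n"
    and first: "a \<in> P \<Longrightarrow> a ! 0 \<in> R"
    and adj: "a \<in> P \<Longrightarrow> Suc i < n \<Longrightarrow> a ! i \<noteq> 0 \<Longrightarrow> a ! i \<noteq> a ! Suc i"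
    and swap: "a \<in> P \<Longrightarrow> Suc i < n \<Longrightarrow> a ! i \<noteq> a ! Suc i \<Longrightarrow> a ! Suc i \<noteq> t * a ! i \<Longrightarrow>
       a ! i \<noteq> t * a ! Suc i \<Longrightarrow> a[i := a ! Suc i, Suc i := a ! i] \<in> P"
    and no_sandwich: "a \<in> P \<Longrightarrow> Suc (Suc i) < n \<Longrightarrow> a ! Suc (Suc i) = a ! i \<Longrightarrow> a ! i \<noteq> 0 \<Longrightarrow>
       a ! Suc i \<noteq> t * a ! i \<and> a ! i \<noteq> t * a ! Suc i"
begin

text \<open>The obstruction to exchanging distinct neighbours. The values linked to
  \<open>v k * q powi (2 * z)\<close> are those with exponent z - 1 or z + 1 in place of z.\<close>

definition linked :: "'k \<Rightarrow> 'k \<Rightarrow> bool" where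
  "linked x y \<longleftrightarrow> y = t * x \<or> x = t * y"

lemma swap_linked:
  assumes "a \<in> P" "Suc i < n" "a ! i \<noteq> 0 \<or> a ! Suc i \<noteq> 0" "\<not> linked (a ! i) (a ! Suc i)"
  shows "a[i := a ! Suc i, Suc i := a ! i] \<in> P"
  using assms adj[of a i] by (intro swap) (auto simp: linked_def)

lemma swap_nth:
  assumes "a \<in> P" "Suc i < n"
  shows "a[i := a ! Suc i, Suc i := a ! i] ! k =
    (if k = i then a ! Suc i else if k = Suc i then a ! i else a ! k)"
  using assms len[OF assms(1)] by auto

text \<open>Without a linked predecessor, the entry could be moved to the front, where only elements
  of \<open>R\<close> stand.\<close>

lemma linked_before:
  assumes "a \<in> P" "j < n" "a ! j \<noteq> 0" "a ! j \<notin> R"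
  shows "\<exists>l<j. linked (a ! l) (a ! j)"
  using assms
proof (induction j arbitrary: a)
  case 0
  then show ?case using first by auto
next
  case (Suc j)
  show ?case
  proof (rule ccontr)
    assume no: "\<not> ?thesis"
    define a' where "a' = a[j := a ! Suc j, Suc j := a ! j]"
    have a': "a' \<in> P" unfolding a'_def using Suc no by (intro swap_linked) auto
    have nth: "a' ! k = (if k = j then a ! Suc j else if k = Suc j then a ! j else a ! k)" for k
      unfolding a'_def using Suc by (intro swap_nth)
    have "\<exists>l<j. linked (a' ! l) (a' ! j)"
      using Suc a' by (intro Suc.IH) (auto simp: nth)
    then show False using no by (auto simp: nth dest: less_SucI)
  qed
qed

text \<open>Otherwise the right one of the two equal entries could be moved next to the left one,
  against \<open>adj\<close>.\<close>

lemma linked_between: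
  assumes "a \<in> P" "i < j" "j < n" "a ! i = a ! j" "a ! j \<noteq> 0"
  shows "\<exists>l\<in>{i<..<j}. linked (a ! l) (a ! j)"
  using assms
proof (induction j arbitrary: a)
  case 0
  then show ?case by simp
next
  case (Suc j)
  show ?case
  proof (rule ccontr)
    assume no: "\<not> ?thesis"
    have "i \<noteq> j" using Suc adj[of a i] by auto
    then have ij: "i < j" using Suc by simp
    define a' where "a' = a[j := a ! Suc j, Suc j := a ! j]"
    have a': "a' \<in> P" unfolding a'_def using Suc no ij by (intro swap_linked) auto
    have nth: "a' ! k = (if k = j then a ! Suc j else if k = Suc j then a ! j else a ! k)" for k
      unfolding a'_def using Suc by (intro swap_nth) auto
    have "\<exists>l\<in>{i<..<j}. linked (a' ! l) (a' ! j)"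
      using Suc a' ij by (intro Suc.IH) (auto simp: nth)
    then show False using no by (auto simp: nth)
  qed
qed

text \<open>With a single linked entry between two equal ones, swaps bring the three of them together.\<close>

lemma not_unique_linked_between:
  assumes "a \<in> P" "i < l" "l < j" "j < n" "a ! i = a ! j" "a ! j \<noteq> 0" "linked (a ! l) (a ! j)"
    and "\<And>m. i < m \<Longrightarrow> m < j \<Longrightarrow> linked (a ! m) (a ! j) \<Longrightarrow> m = l"
  shows False
  using assms
proof (induction "j - i" arbitrary: a i j rule: less_induct)
  case less
  \<comment> \<open>As long as there is room on one side of \<open>l\<close>, the equal entry on
    that side moves inward past an unlinked one; when no room is left, \<open>no_sandwich\<close>
    applies.\<close>
  consider "j > Suc l" | "Suc i < l" | "j = Suc l" "l = Suc i" using less.prems by linarith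
  then show ?case
  proof cases
    case 1
    then obtain k where k: "j = Suc k" "l < k" by (cases j) auto
    define a' where "a' = a[k := a ! Suc k, Suc k := a ! k]"
    have "\<not> linked (a ! k) (a ! Suc k)"
      using k less.prems(2,3) less.prems(8)[of k] by (metis less_trans lessI less_irrefl)
    then have a': "a' \<in> P" unfolding a'_def using less.prems(1,4,6) k by (intro swap_linked) auto
    have nth: "a' ! m = (if m = k then a ! Suc k else if m = Suc k then a ! k else a ! m)" for m
      unfolding a'_def using less.prems(1,4) k by (intro swap_nth) auto
    show False
    proof (rule less.hyps[of k i a'])
      show "m = l" if "i < m" "m < k" "linked (a' ! m) (a' ! k)" for m
        using that less.prems(8)[of m] k by (simp add: nth)
    qed (use less.prems(2-7) k a' in \<open>simp_all add: nth\<close>)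
  next
    case 2
    define a' where "a' = a[i := a ! Suc i, Suc i := a ! i]"
    have "\<not> linked (a ! i) (a ! Suc i)"
      using 2 less.prems(3,5) less.prems(8)[of "Suc i"] by (auto simp: linked_def)
    then have a': "a' \<in> P" unfolding a'_def using less.prems(1-6) 2 by (intro swap_linked) auto
    have nth: "a' ! m = (if m = i then a ! Suc i else if m = Suc i then a ! i else a ! m)" for m
      unfolding a'_def using less.prems(1-4) by (intro swap_nth) auto
    show False
    proof (rule less.hyps[of j "Suc i" a'])
      show "m = l" if "Suc i < m" "m < j" "linked (a' ! m) (a' ! j)" for m
        using that less.prems(8)[of m] by (simp add: nth)
    qed (use less.prems(2-7) 2 a' in \<open>simp_all add: nth\<close>)
  next
    case 3
    then show False
      using less.prems(4-7) no_sandwich[OF less.prems(1), of i] by (simp add: linked_def)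
  qed
qed

text \<open>
  Induction on the distance of the two equal entries. If a linked value \<open>y\<close> does not occur between
  them, then the other one, \<open>y'\<close>, occurs at least twice. Between its two occurrences there is
  the original entry again, and this gives a closer pair of equal entries that does enclose \<open>y\<close>.
\<close>

lemma all_linked_between:
  assumes "a \<in> P" "i < j" "j < n" "a ! i = a ! j" "a ! j \<noteq> 0" "linked y (a ! j)"
  shows "y \<in> (!) a ` {i<..<j}"
  using assms
proof (induction "j - i" arbitrary: i j y rule: less_induct)
  case less
  show ?case
  proof (rule ccontr)
    assume no: "y \<notin> (!) a ` {i<..<j}"
    obtain l where l: "i < l" "l < j" "linked (a ! l) (a ! j)"
      using linked_between[OF less.prems(1-5)] by auto
    have missing: "a ! m \<noteq> y" if "i < m" "m < j" for m
      using no that by force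
    \<comment> \<open>A value has at most two linked values; with \<open>y\<close> excluded, only
      one can occur.\<close>
    have eq: "a ! m = a ! l" if "i < m" "m < j" "linked (a ! m) (a ! j)" for m
      using missing[OF that(1,2)] missing[OF l(1,2)] that(3) l(3) less.prems(6) t
      by (auto simp: linked_def)
    \<comment> \<open>The entries at \<open>m\<close> and \<open>m'\<close> are equal, so by
      induction they enclose a copy of \<open>a ! j\<close>, at \<open>r\<close>. The pair
      \<open>i\<close>, \<open>r\<close> is again shorter and must enclose \<open>y\<close>.\<close>
    have closer: False if m: "i < m" "m < m'" "m' < j" "linked (a ! m) (a ! j)" "linked (a ! m') (a ! j)"
      for m m'
    proof -
      have "a ! j \<in> (!) a ` {m<..<m'}"
      proof (rule less.hyps)
        show "a ! m = a ! m'" using eq[of m] eq[of m'] m by simp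
        show "a ! m' \<noteq> 0" "linked (a ! j) (a ! m')"
          using m(5) less.prems(5) t by (auto simp: linked_def)
      qed (use m less.prems(1-3) in simp_all)
      then obtain r where r: "m < r" "r < m'" "a ! r = a ! j" by auto
      have "y \<in> (!) a ` {i<..<r}"
        using r m less.prems(1-6) by (intro less.hyps) auto
      then show False using no r m by auto
    qed
    have "m = l" if "i < m" "m < j" "linked (a ! m) (a ! j)" for m
      using closer[of m l] closer[of l m] that l by (metis linorder_neqE_nat)
    then show False using not_unique_linked_between[OF less.prems(1) l(1,2) less.prems(3-5) l(3)] by blast
  qed
qed

end

section \<open>Representations of the cyclotomic Hecke algebra\<close>

lemma Hcls_ring_hom: "Hcls q v n \<in> ring_hom (free_algebra (hgens n)) (Hecke q v n)"
proof -
  have "Hcls q v n = (+>\<^bsub>free_algebra (hgens n)\<^esub>) (Idl\<^bsub>free_algebra (hgens n)\<^esub> (hrels q v n))"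
    by (rule ext) (simp add: Hcls_def)
  then show ?thesis
    unfolding Hecke_def
    by (simp only:) (intro ideal.rcos_ring_hom ring.genideal_ideal ring_free_algebra hrels_subset)
qed

lemma Hcls_hrels:
  assumes "p \<in> hrels q v n"
  shows "Hcls q v n p = \<zero>\<^bsub>Hecke q v n\<^esub>"
proof -
  interpret F: ring "free_algebra (hgens n) :: (hgen free_mon \<Rightarrow>\<^sub>0 'a) ring"
    by (rule ring_free_algebra)
  interpret I: ideal "Idl\<^bsub>free_algebra (hgens n)\<^esub> (hrels q v n)" "free_algebra (hgens n)"
    by (rule F.genideal_ideal[OF hrels_subset])
  have "p \<in> Idl\<^bsub>free_algebra (hgens n)\<^esub> (hrels q v n)"
    using assms F.genideal_self[OF hrels_subset] by blast
  then show ?thesis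
    unfolding Hcls_def Hecke_def by (simp add: I.a_rcos_const FactRing_def)
qed

lemma free_algebra_closed:
  fixes p r :: "'g free_mon \<Rightarrow>\<^sub>0 'k::field"
  shows "p \<in> carrier (free_algebra X) \<Longrightarrow> r \<in> carrier (free_algebra X) \<Longrightarrow> p + r \<in> carrier (free_algebra X)"
    and "p \<in> carrier (free_algebra X) \<Longrightarrow> r \<in> carrier (free_algebra X) \<Longrightarrow> p * r \<in> carrier (free_algebra X)"
    and "p \<in> carrier (free_algebra X) \<Longrightarrow> r \<in> carrier (free_algebra X) \<Longrightarrow> p - r \<in> carrier (free_algebra X)"
    and "1 \<in> carrier (free_algebra X :: ('g free_mon \<Rightarrow>\<^sub>0 'k) ring)"
    and "fconst c \<in> carrier (free_algebra X :: ('g free_mon \<Rightarrow>\<^sub>0 'k) ring)"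
    and "g \<in> X \<Longrightarrow> fvar g \<in> carrier (free_algebra X :: ('g free_mon \<Rightarrow>\<^sub>0 'k) ring)"
proof -
  interpret F: ring "free_algebra X :: ('g free_mon \<Rightarrow>\<^sub>0 'k) ring"
    by (rule ring_free_algebra)
  let ?C = "carrier (free_algebra X :: ('g free_mon \<Rightarrow>\<^sub>0 'k) ring)"
  show add: "p + r \<in> ?C" if "p \<in> ?C" "r \<in> ?C" for p r
    using F.a_closed[OF that] by (simp only: free_algebra_fields)
  show "p * r \<in> ?C" if "p \<in> ?C" "r \<in> ?C"
    using F.m_closed[OF that] by (simp only: free_algebra_fields)
  have "- r \<in> ?C" if "r \<in> ?C"
    using that unfolding free_algebra_carrier keys_uminus_free .
  then show "p - r \<in> ?C" if "p \<in> ?C" "r \<in> ?C"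
    using add[of p "- r"] that by simp
  show "1 \<in> ?C" "fconst c \<in> ?C"
    by (auto simp: free_algebra_carrier fconst_def zero_free_mon_def)
  show "fvar g \<in> ?C" if "g \<in> X"
    using that by (simp add: free_algebra_carrier fvar_def)
qed

locale Hecke_representation =
  fixes q :: "'k::field" and v :: "'m::{finite,linorder} \<Rightarrow> 'k" and n :: nat
    and scale :: "'k \<Rightarrow> 'v::ab_group_add \<Rightarrow> 'v" and \<rho> :: "(hgen free_mon \<Rightarrow>\<^sub>0 'k) set \<Rightarrow> 'v \<Rightarrow> 'v"
  assumes rep: "representation q v n scale \<rho>"
begin

sublocale vector_space scale
  using rep unfolding Defs.representation_def by blast

interpretation H: ring "Hecke q v n" by (rule ring_Hecke)

lemma rho_hom: "\<rho> \<in> ring_hom (Hecke q v n) (End_ring scale)"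
  using rep unfolding Defs.representation_def by blast

lemma rho_linear: "x \<in> carrier (Hecke q v n) \<Longrightarrow> Vector_Spaces.linear scale scale (\<rho> x)"
  using ring_hom_closed[OF rho_hom] by (simp add: End_ring_def)

lemma rho_mult: "x \<in> carrier (Hecke q v n) \<Longrightarrow> y \<in> carrier (Hecke q v n) \<Longrightarrow>
    \<rho> (x \<otimes>\<^bsub>Hecke q v n\<^esub> y) w = \<rho> x (\<rho> y w)"
  using ring_hom_mult[OF rho_hom, of x y] by (simp add: End_ring_def)

lemma rho_add: "x \<in> carrier (Hecke q v n) \<Longrightarrow> y \<in> carrier (Hecke q v n) \<Longrightarrow>
    \<rho> (x \<oplus>\<^bsub>Hecke q v n\<^esub> y) w = \<rho> x w + \<rho> y w"
  using ring_hom_add[OF rho_hom, of x y] by (simp add: End_ring_def)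

lemma rho_one: "\<rho> \<one>\<^bsub>Hecke q v n\<^esub> w = w"
  using ring_hom_one[OF rho_hom] by (simp add: End_ring_def)

lemma rho_zero: "\<rho> \<zero>\<^bsub>Hecke q v n\<^esub> w = 0"
  using rho_add[of "\<zero>\<^bsub>Hecke q v n\<^esub>" "\<zero>\<^bsub>Hecke q v n\<^esub>" w] by simp

lemma rho_a_inv:
  assumes x: "x \<in> carrier (Hecke q v n)"
  shows "\<rho> (\<ominus>\<^bsub>Hecke q v n\<^esub> x) w = - \<rho> x w"
proof -
  have "\<rho> (\<ominus>\<^bsub>Hecke q v n\<^esub> x) w + \<rho> x w = \<rho> (\<ominus>\<^bsub>Hecke q v n\<^esub> x \<oplus>\<^bsub>Hecke q v n\<^esub> x) w"
    using x by (intro rho_add[symmetric]) auto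
  then show ?thesis using x by (simp add: H.l_neg rho_zero eq_neg_iff_add_eq_0)
qed

text \<open>Pulling the representation back to the free algebra replaces calculations with cosets by
  calculations with noncommutative polynomials.\<close>

definition act :: "(hgen free_mon \<Rightarrow>\<^sub>0 'k) \<Rightarrow> 'v \<Rightarrow> 'v" where
  "act p = \<rho> (Hcls q v n p)"

abbreviation C :: "(hgen free_mon \<Rightarrow>\<^sub>0 'k) set" where
  "C \<equiv> carrier (free_algebra (hgens n))"

lemma Hcls_closed: "p \<in> C \<Longrightarrow> Hcls q v n p \<in> carrier (Hecke q v n)"
  by (rule ring_hom_closed[OF Hcls_ring_hom])

lemma act_linear: "p \<in> C \<Longrightarrow> Vector_Spaces.linear scale scale (act p)"
  unfolding act_def by (intro rho_linear Hcls_closed)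

lemma act_mult: "p \<in> C \<Longrightarrow> r \<in> C \<Longrightarrow> act (p * r) w = act p (act r w)"
  using ring_hom_mult[OF Hcls_ring_hom, of p n r q v] rho_mult[OF Hcls_closed Hcls_closed, of p r w]
  by (simp add: act_def free_algebra_fields)

lemma act_add: "p \<in> C \<Longrightarrow> r \<in> C \<Longrightarrow> act (p + r) w = act p w + act r w"
  using ring_hom_add[OF Hcls_ring_hom, of p n r q v] rho_add[OF Hcls_closed Hcls_closed, of p r w]
  by (simp add: act_def free_algebra_fields)

lemma act_one: "act 1 w = w"
  using ring_hom_one[OF Hcls_ring_hom, of q v n] by (simp add: act_def free_algebra_fields rho_one)

lemma act_fconst: "act (fconst c) w = scale c w"
  using rep unfolding Defs.representation_def act_def Hscalar_def by metis

lemma act_diff: "p \<in> C \<Longrightarrow> r \<in> C \<Longrightarrow> act (p - r) w = act p w - act r w"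
  using act_add[of "p - r" r w] by (simp add: free_algebra_closed)

lemma act_hrels: "p \<in> hrels q v n \<Longrightarrow> act p w = 0"
  by (simp add: act_def Hcls_hrels rho_zero)

lemma act_eqI: "p - r \<in> hrels q v n \<Longrightarrow> p \<in> C \<Longrightarrow> r \<in> C \<Longrightarrow> act p w = act r w"
  using act_hrels[of "p - r" w] by (simp add: act_diff)

abbreviation T :: "'v \<Rightarrow> 'v" where "T \<equiv> act (fvar Tau)"

abbreviation S :: "nat \<Rightarrow> 'v \<Rightarrow> 'v" where "S i \<equiv> act (fvar (Sig i))"

lemma Tau_closed: "fvar Tau \<in> C"
  by (rule free_algebra_closed) (simp add: hgens_def)

lemma Sig_closed: "1 \<le> i \<Longrightarrow> i < n \<Longrightarrow> fvar (Sig i) \<in> C"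
  by (rule free_algebra_closed) (simp add: hgens_def)

lemmas act_simps = act_mult act_add act_one act_fconst free_algebra_closed Tau_closed Sig_closed

section \<open>The defining relations as operator identities\<close>

lemma S_braid:
  assumes "1 \<le> i" "Suc i < n"
  shows "S i (S (Suc i) (S i x)) = S (Suc i) (S i (S (Suc i) x))"
proof -
  have "act (fvar (Sig i) * fvar (Sig (i + 1)) * fvar (Sig i)) x
      = act (fvar (Sig (i + 1)) * fvar (Sig i) * fvar (Sig (i + 1))) x"
    by (rule act_eqI) (use assms in \<open>auto simp: hrels_def Let_def act_simps\<close>)
  then show ?thesis using assms by (simp add: act_simps)
qed

lemma S_commute:
  assumes "1 \<le> i" "Suc i < j" "j < n"
  shows "S i (S j x) = S j (S i x)"
proof -
  have "\<bar>int i - int j\<bar> > 1" using assms by simp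
  then have "fvar (Sig i) * fvar (Sig j) - fvar (Sig j) * fvar (Sig i) \<in> hrels q v n"
    using assms unfolding hrels_def Let_def
    by (intro UnI1 UnI2 CollectI exI[of _ i] exI[of _ j]) auto
  then have "act (fvar (Sig i) * fvar (Sig j)) x = act (fvar (Sig j) * fvar (Sig i)) x"
    by (rule act_eqI) (use assms in \<open>auto simp: act_simps\<close>)
  then show ?thesis using assms by (simp add: act_simps)
qed

lemma T_S:
  assumes "1 < i" "i < n"
  shows "T (S i x) = S i (T x)"
proof -
  have "act (fvar Tau * fvar (Sig i)) x = act (fvar (Sig i) * fvar Tau) x"
    by (rule act_eqI) (use assms in \<open>auto simp: hrels_def Let_def act_simps\<close>)
  then show ?thesis using assms by (simp add: act_simps)
qed

lemma S_quad:
  assumes "1 \<le> i" "i < n"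
  shows "S i (S i x) = scale (q - inverse q) (S i x) + x"
proof -
  have "act (fvar (Sig i) * fvar (Sig i)) x = act (fconst (q - inverse q) * fvar (Sig i) + 1) x"
    by (rule act_eqI) (use assms in \<open>auto simp: hrels_def Let_def act_simps\<close>)
  then show ?thesis using assms by (simp add: act_simps)
qed

text \<open>The cyclotomic relation acts on \<open>e\<close> by the product of all
  \<open>c - v k\<close>, so one of these factors is zero.\<close>

lemma T_eigenvalue:
  assumes e: "e \<noteq> 0" "T e = scale c e"
  shows "c \<in> range v"
proof -
  have factor: "fvar Tau - fconst x \<in> C" for x
    by (intro free_algebra_closed Tau_closed)
  have closed: "prod_list (map (\<lambda>k. fvar Tau - fconst (v k)) ks) \<in> C" for ks
    by (induction ks) (auto intro: free_algebra_closed factor)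
  have "act (prod_list (map (\<lambda>k. fvar Tau - fconst (v k)) ks)) e = scale (prod_list (map (\<lambda>k. c - v k) ks)) e" for ks
  proof (induction ks)
    case Nil
    then show ?case by (simp add: act_one)
  next
    case (Cons k ks)
    interpret f: Vector_Spaces.linear scale scale "act (fvar Tau - fconst (v k))"
      by (rule act_linear[OF factor])
    have "act (fvar Tau - fconst (v k)) e = scale (c - v k) e"
      using e(2) by (simp add: act_diff act_simps scale_left_diff_distrib)
    then show ?case
      using Cons by (simp add: act_mult[OF factor closed] f.scale mult.commute)
  qed
  moreover have "act (prod_list (map (\<lambda>k. fvar Tau - fconst (v k)) (sorted_list_of_set UNIV))) e = 0"
    by (rule act_hrels) (simp add: hrels_def Let_def)
  ultimately have "prod_list (map (\<lambda>k. c - v k) (sorted_list_of_set UNIV)) = 0"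
    using e(1) by simp
  then show ?thesis by (auto simp: prod_list_zero_iff)
qed

section \<open>Jucys-Murphy elements and generated subalgebras\<close>

lemma Hsigma_closed: "1 \<le> i \<Longrightarrow> i < n \<Longrightarrow> Hsigma q v n i \<in> carrier (Hecke q v n)"
  unfolding Hsigma_def by (intro Hcls_closed Sig_closed)

lemma JM_closed: "1 \<le> i \<Longrightarrow> i \<le> n \<Longrightarrow> JM q v n i \<in> carrier (Hecke q v n)"
proof (induction i rule: nat_induct_at_least)
  case base
  then show ?case by (simp add: Htau_def Hcls_closed Tau_closed)
next
  case (Suc i)
  then show ?case by (cases i) (auto intro!: H.m_closed Hsigma_closed)
qed

lemma rho_JM_Suc:
  assumes "1 \<le> i" "i < n"
  shows "\<rho> (JM q v n (Suc i)) x = S i (\<rho> (JM q v n i) (S i x))"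
proof -
  obtain k where k: "i = Suc k" using assms by (cases i) auto
  note cl = JM_closed[of i] Hsigma_closed[of i]
  have "JM q v n (Suc i) = Hsigma q v n i \<otimes>\<^bsub>Hecke q v n\<^esub> JM q v n i \<otimes>\<^bsub>Hecke q v n\<^esub> Hsigma q v n i"
    unfolding k by simp
  then show ?thesis using assms cl by (simp add: rho_mult act_def Hsigma_def)
qed

lemma subalgebra_gen_closed:
  assumes "X \<subseteq> carrier (Hecke q v n)" "x \<in> subalgebra_gen q v n X"
  shows "x \<in> carrier (Hecke q v n)"
proof -
  have "range (Hscalar q v n) \<subseteq> carrier (Hecke q v n)"
    unfolding Hscalar_def by (auto intro!: Hcls_closed free_algebra_closed)
  then show ?thesis
    using H.generate_ring_in_carrier[of "range (Hscalar q v n) \<union> X" x] assms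
    unfolding subalgebra_gen_def by blast
qed

text \<open>For fixed \<open>w\<close>, the elements that multiply \<open>w\<close> by a scalar are
  closed under the ring operations and include the constants.\<close>

lemma preserves_eigenlines_subalgebra_gen:
  assumes X: "X \<subseteq> carrier (Hecke q v n)"
  shows "preserves_eigenlines scale (\<rho> ` X) (\<rho> ` subalgebra_gen q v n X)"
  unfolding preserves_eigenlines_def
proof (intro allI impI ballI)
  fix w g assume w: "\<forall>f\<in>\<rho> ` X. \<exists>c. f w = scale c w" and "g \<in> \<rho> ` subalgebra_gen q v n X"
  then obtain x where x: "x \<in> subalgebra_gen q v n X" and g: "g = \<rho> x" by blast
  note cl = subalgebra_gen_closed[OF X, unfolded subalgebra_gen_def]
  from x have "\<exists>c. \<rho> x w = scale c w"
    unfolding subalgebra_gen_def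
  proof (induction rule: generate_ring.induct)
    case one
    show ?case by (rule exI[of _ 1]) (simp add: rho_one)
  next
    case (incl h)
    then show ?case using w rep unfolding Defs.representation_def by fastforce
  next
    case (a_inv h)
    then show ?case by (metis cl rho_a_inv scale_minus_left)
  next
    case (eng_add h1 h2)
    then show ?case by (metis cl rho_add scale_left_distrib)
  next
    case (eng_mult h1 h2)
    then obtain c d where cd: "\<rho> h1 w = scale c w" "\<rho> h2 w = scale d w" by blast
    interpret h1: Vector_Spaces.linear scale scale "\<rho> h1"
      by (rule rho_linear[OF cl[OF eng_mult.hyps(1)]])
    show ?case
      using cd eng_mult.hyps by (intro exI[of _ "d * c"]) (simp add: rho_mult cl h1.scale)
  qed
  then show "\<exists>c. g w = scale c w" unfolding g .
qed

lemma JM_operators: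
  assumes C: "C_representation q v n scale \<rho>" and q: "q \<noteq> 0"
  shows "JM_operators scale q n (\<lambda>i. \<rho> (JM q v n i)) S"
proof (intro JM_operators.intro JM_operators_axioms.intro)
  fix i assume i: "1 \<le> i" "i < n"
  let ?X = "{JM q v n i, JM q v n (Suc i), Hsigma q v n i}"
  have X: "?X \<subseteq> carrier (Hecke q v n)"
    using i by (auto intro!: JM_closed Hsigma_closed simp del: JM.simps)
  have im: "\<rho> ` ?X = {\<rho> (JM q v n i), \<rho> (JM q v n (Suc i)), S i}"
    by (simp add: act_def Hsigma_def)
  let ?A = "\<rho> ` subalgebra_gen q v n ?X"
  have "completely_reducible scale ?A"
    using C i unfolding C_representation_def by auto
  moreover have "\<rho> ` ?X \<subseteq> ?A"
    unfolding subalgebra_gen_def by (intro image_mono) (auto intro: generate_ring.incl)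
  moreover have "\<forall>g\<in>?A. Vector_Spaces.linear scale scale g"
    using subalgebra_gen_closed[OF X] rho_linear by blast
  moreover have "preserves_eigenlines scale (\<rho> ` ?X) ?A"
    by (rule preserves_eigenlines_subalgebra_gen[OF X])
  ultimately show "\<exists>A. completely_reducible scale A \<and>
      {\<rho> (JM q v n i), \<rho> (JM q v n (Suc i)), S i} \<subseteq> A \<and>
      (\<forall>g\<in>A. Vector_Spaces.linear scale scale g) \<and>
      preserves_eigenlines scale {\<rho> (JM q v n i), \<rho> (JM q v n (Suc i)), S i} A"
    unfolding im by blast
next
  fix i x assume "1 < i" "i < n"
  then show "\<rho> (JM q v n 1) (S i x) = S i (\<rho> (JM q v n 1) x)"
    using T_S by (simp add: act_def Htau_def)
next
  fix i assume "1 \<le> i" "i \<le> n"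
  then show "Vector_Spaces.linear scale scale (\<rho> (JM q v n i))"
    by (intro rho_linear JM_closed)
next
  fix i assume "1 \<le> i" "i \<le> n"
  then show "diagonalizable scale (\<rho> (JM q v n i))"
    using C unfolding C_representation_def by auto
next
  fix i assume "1 \<le> i" "i < n"
  then show "Vector_Spaces.linear scale scale (S i)"
    by (intro act_linear Sig_closed)
qed (fact vector_space_axioms S_quad S_braid S_commute rho_JM_Suc q)+

end

text \<open>Stated over an arbitrary field, so that the generic and the complex parameters are
  treated at once.\<close>

lemma Spec_subset_Cont:
  fixes q :: "'k::field" and v :: "'m::{finite,linorder} \<Rightarrow> 'k"
  assumes n: "n \<ge> 1" and q: "q \<noteq> 0" and q2: "n \<ge> 2 \<Longrightarrow> q\<^sup>2 \<noteq> 1" "n \<ge> 2 \<Longrightarrow> q\<^sup>2 \<noteq> - 1"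
    and v: "\<And>k. v k \<noteq> 0"
  shows "Spec q v n TYPE('v::ab_group_add) \<subseteq> Cont q v n"
proof
  fix a assume "a \<in> Spec q v n TYPE('v)"
  then obtain scale :: "'k \<Rightarrow> 'v \<Rightarrow> 'v" and \<rho> e where
    len: "length a = n" and rep: "C_representation q v n scale \<rho>"
    and e: "e \<noteq> 0" "\<forall>i\<in>{1..n}. \<rho> (JM q v n i) e = scale (a ! (i - 1)) e"
    unfolding Spec_def by auto
  interpret R: Hecke_representation q v n scale \<rho>
    by standard (use rep in \<open>simp add: C_representation_def\<close>)
  interpret J: JM_operators scale q n "\<lambda>i. \<rho> (JM q v n i)" R.S
    by (rule R.JM_operators[OF rep q])
  have a: "a \<in> J.weights"
    using len e unfolding J.weights_def by force
  have first: "b ! 0 \<in> range v" if b: "b \<in> J.weights" for b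
  proof -
    obtain f where "f \<noteq> 0" "\<rho> (JM q v n (Suc 0)) f = scale (b ! 0) f"
      using b n unfolding J.weights_def by force
    then show ?thesis by (intro R.T_eigenvalue[of f]) (simp_all add: R.act_def Htau_def)
  qed
  interpret swap_closed "q\<^sup>2" n "range v" J.weights
  proof (rule swap_closed.intro)
    \<comment> \<open>An index with \<open>Suc i < n\<close> exists only if \<open>n\<close> is at
      least 2, which makes \<open>q2\<close> available.\<close>
    show "b ! i \<noteq> b ! Suc i" if "b \<in> J.weights" "Suc i < n" "b ! i \<noteq> 0" for b i
      using J.weights_distinct[OF that] q2(1) that by simp
    show "b ! Suc i \<noteq> q\<^sup>2 * b ! i \<and> b ! i \<noteq> q\<^sup>2 * b ! Suc i"
      if "b \<in> J.weights" "Suc (Suc i) < n" "b ! Suc (Suc i) = b ! i" "b ! i \<noteq> 0" for b i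
      using J.weights_no_sandwich[OF that] q2 that by simp
    show "length b = n" if "b \<in> J.weights" for b
      using that by (simp add: J.weights_def)
  qed (use q first J.weights_swap in simp_all)
  \<comment> \<open>These translate \<open>linked\<close> into a shift of the exponent z by
    one.\<close>
  have up: "v k * q powi (2 * (z + 1)) = q\<^sup>2 * (v k * q powi (2 * z))" for k and z :: int
    using q by (simp add: distrib_left power_int_add)
  have down: "v k * q powi (2 * z) = q\<^sup>2 * (v k * q powi (2 * (z - 1)))" for k and z :: int
    using up[of k "z - 1"] by simp
  have nz: "v k * q powi (2 * z) \<noteq> 0" for k and z :: int
    using q v by simp
  show "a \<in> Cont q v n"
    unfolding Cont_def
  proof (intro CollectI conjI allI impI len first a)
    fix j k and z :: int
    assume *: "0 < j \<and> j < n \<and> z \<noteq> 0 \<and> a ! j = v k * q powi (2 * z) \<and> a ! j \<notin> range v"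
    then have aj: "a ! j = v k * q powi (2 * z)" by blast
    obtain l where l: "l < j" "linked (a ! l) (a ! j)"
      using linked_before[OF a, of j] * nz[of k z] by auto
    have "a ! l = v k * q powi (2 * (z - 1)) \<or> a ! l = v k * q powi (2 * (z + 1))"
      using l(2) q unfolding linked_def aj up by (subst (asm) down) auto
    then show "{v k * q powi (2 * (z - 1)), v k * q powi (2 * (z + 1))} \<inter> (!) a ` {0..<j} \<noteq> {}"
      using l(1) by force
  next
    fix i j k and z :: int
    assume *: "i < j \<and> j < n \<and> a ! i = a ! j \<and> a ! j = v k * q powi (2 * z)"
    then have aj: "a ! j = v k * q powi (2 * z)" by blast
    have "linked (v k * q powi (2 * (z - 1))) (a ! j)" "linked (v k * q powi (2 * (z + 1))) (a ! j)"
      unfolding linked_def aj using up down by blast+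
    then show "{v k * q powi (2 * (z - 1)), v k * q powi (2 * (z + 1))} \<subseteq> (!) a ` {i<..<j}"
      using all_linked_between[OF a, of i j] * nz[of k z] by auto
  qed
qed

lemma indet_nonzero: "indet x \<noteq> (0 :: 'm::{finite,linorder} ratfun)"
  by (simp add: indet_def Fraction_Field.Zero_fract_def Fraction_Field.eq_fract)
    (metis lookup_single_eq lookup_zero zero_neq_one)

text \<open>A value 1 would be a coincidence between \<open>v k\<close> and itself with exponent z =
  2. The fourth power serves to exclude 1 and -1 as values of q^2 together.\<close>

lemma generic_q_power4: "generic_q ^ 4 \<noteq> (1 :: 'm::{finite,linorder} ratfun)"
proof -
  have "generic_v k * generic_q powi (2 * 2) \<noteq> (generic_v k :: 'm ratfun)" for k
    by (rule generic_no_coincidence) simp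
  then show ?thesis by (auto simp: power_int_def)
qed

theorem proposition3:
  fixes n :: nat
  assumes "n \<ge> 1"
  shows
    "(\<forall>a. a \<in> Spec generic_q (generic_v :: 'm::{finite,linorder} \<Rightarrow> 'm ratfun) n TYPE('v::ab_group_add)
          \<longrightarrow> a \<in> Cont generic_q generic_v n) \<and>
     (\<forall>(q::complex) (v :: 'm \<Rightarrow> complex) a.
          admissible q v n \<and> (n \<ge> 2 \<longrightarrow> q\<^sup>2 \<noteq> 1) \<and> a \<in> Spec q v n TYPE('w::ab_group_add)
          \<longrightarrow> a \<in> Cont q v n)"
proof (intro conjI allI impI)
  fix a assume a: "a \<in> Spec generic_q (generic_v :: 'm \<Rightarrow> 'm ratfun) n TYPE('v)"
  have q4: "generic_q ^ 4 = (generic_q\<^sup>2 :: 'm ratfun)\<^sup>2"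
    by (simp flip: power_mult)
  have "generic_q\<^sup>2 \<noteq> (1 :: 'm ratfun)" "generic_q\<^sup>2 \<noteq> (- 1 :: 'm ratfun)"
    using generic_q_power4[where 'm = 'm] unfolding q4 by (metis one_power2 power2_minus)+
  then show "a \<in> Cont generic_q generic_v n"
    using Spec_subset_Cont[OF assms, of generic_q generic_v] a
    by (auto simp: generic_q_def generic_v_def indet_nonzero)
next
  fix q :: complex and v :: "'m \<Rightarrow> complex" and a
  assume *: "admissible q v n \<and> (n \<ge> 2 \<longrightarrow> q\<^sup>2 \<noteq> 1) \<and> a \<in> Spec q v n TYPE('w)"
  have q2: "q\<^sup>2 \<noteq> - 1" if "n \<ge> 2"
  proof -
    have "\<forall>N<n. (\<Sum>i\<le>N. q ^ (2 * i)) \<noteq> 0"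
      using * unfolding admissible_def by blast
    \<comment> \<open>The sum for N = 1 is 1 + q^2.\<close>
    from this[rule_format, of 1] have "(\<Sum>i\<le>1. q ^ (2 * i)) \<noteq> 0"
      using that by simp
    then show ?thesis by auto
  qed
  have nz: "q \<noteq> 0" "v k \<noteq> 0" for k
    using * unfolding admissible_def by simp_all
  have "Spec q v n TYPE('w) \<subseteq> Cont q v n"
    by (rule Spec_subset_Cont) (use assms * q2 nz in simp_all)
  then show "a \<in> Cont q v n" using * by blast
qed

end
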